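(* Let $n\ge 1$ and let $F_1,\dots,F_n$ be matchings, each consisting of exactly $n$ edges. A rainbow matching is a matching $M$ whose edges can be assigned injectively to indices $i\in[n]$ such that each edge lies in the matching $F_i$ of its assigned index (i.e. $M=\{x_{i_1},\dots,x_{i_m}\}$ with $i_1<\dots<i_m$ and $x_{i_j}\in F_{i_j}$, the $x_{i_j}$ pairwise disjoint). Then: \begin{enumerate} \item If $F_1,\dots,F_n$ are matchings in a graph, there is a rainbow matching of size at least $\frac{2}{3}n-\frac{4}{3}$. \item If $r\ge 2$ is an integer and $F_1,\dots,F_n$ are matchings in an $r$-uniform hypergraph, there is a rainbow matching of size at least $\dfrac{n-\frac{1}{2}-\frac{3}{4r-6}}{r-\frac{1}{2}}$. \item If $F_1,\dots,F_n$ are matchings in a graph containing no cycle of length $3$ and no cycle of length $5$, there is a rainbow matching of size at least $\frac{3}{4}n-\frac{9}{4}$. \item If $F_1,\dots,F_n$ are pairwise (edge-)disjoint matchings in a graph, there is a rainbow matching of size at least $\frac{3}{4}n-\frac{9}{2}$. \end{enumerate}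
   Context: All graphs and hypergraphs are finite. The family $(F_1,\dots,F_n)$ is a multiset: the $F_i$ need not be distinct except where stated in part 4. In the paper's notation, part 1 reads $(n,n)\to \frac{2}{3}n-\frac{4}{3}$ and part 2 reads $(n,n)\to_r \frac{n-\frac12-\frac{3}{4r-6}}{r-\frac12}$, where $(a,b)\to_r c$ means every family of $a$ matchings of size $b$ in an $r$-uniform hypergraph has a rainbow matching of size (at least) $c$. *)

theory Defs
  imports Complex_Main "HOL-Library.Disjoint_Sets"
begin

definition uniform_hypergraph :: "nat \<Rightarrow> 'a set \<Rightarrow> 'a set set \<Rightarrow> bool" where
  "uniform_hypergraph r V E \<longleftrightarrow> finite V \<and> (\<forall>e\<in>E. e \<subseteq> V \<and> card e = r)"

abbreviation simple_graph :: "'a set \<Rightarrow> 'a set set \<Rightarrow> bool" where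
  "simple_graph \<equiv> uniform_hypergraph 2"

definition matching :: "'a set set \<Rightarrow> 'a set set \<Rightarrow> bool" where
  "matching E M \<longleftrightarrow> M \<subseteq> E \<and> disjoint M"

text \<open>The family is indexed, so the same matching may occur for several indices.\<close>

definition matching_family :: "'a set set \<Rightarrow> nat \<Rightarrow> (nat \<Rightarrow> 'a set set) \<Rightarrow> bool" where
  "matching_family E n F \<longleftrightarrow> (\<forall>i\<in>{1..n}. matching E (F i) \<and> card (F i) = n)"

definition rainbow_matching ::
    "'a set set \<Rightarrow> nat \<Rightarrow> (nat \<Rightarrow> 'a set set) \<Rightarrow> 'a set set \<Rightarrow> bool" where
  "rainbow_matching E n F M \<longleftrightarrow>
     matching E M \<and> (\<exists>c. inj_on c M \<and> (\<forall>x\<in>M. c x \<in> {1..n} \<and> x \<in> F (c x)))"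

text \<open>A cycle is given by the cyclic sequence of its vertices. It is a subgraph and need not
  be induced.\<close>

definition cycle :: "'a set set \<Rightarrow> 'a list \<Rightarrow> bool" where
  "cycle E vs \<longleftrightarrow> length vs \<ge> 3 \<and> distinct vs \<and>
     (\<forall>i<length vs. {vs ! i, vs ! (Suc i mod length vs)} \<in> E)"

end

(* Let M be a rainbow matching of maximal size m, X its vertex set, U the set of q = n - m unused
   colours, and let a colour j of U belong to C p if some edge of F j meets X exactly in p. No edge
   of a colour in U avoids X, so each such colour has at least 2n - rm edges meeting X in one vertex.

   For general r: two such edges of different colours at different vertices of the same edge e of M
   must intersect, since otherwise they could replace e. Hence at most r colours occur at all
   vertices of e: fix one of them, with edge f at u. The edges of the others at w <> u meet f in
   distinct points, and f has only r - 1 points outside X. So e receives at most (r - 1)q + r pairs,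
   and double counting gives the bound. Part 1 is the case r = 2.

   For parts 3 and 4, an edge of M with many pairs has them all at one end, the hub, and none at the
   other end, the leaf. An unused-colour edge between two leaves would allow replacing two edges of
   M by three, so every edge of an unused colour meets X outside the leaves; hence n is at most 2m
   minus the number of leaves. *)
theory Submission
  imports Defs
begin

section \<open>Short cycles\<close>

lemma cycle_triangle:
  assumes "distinct [a, b, c]" "{a, b} \<in> E" "{b, c} \<in> E" "{c, a} \<in> E"
  shows "cycle E [a, b, c]"
  using assms by (simp add: cycle_def All_less_Suc)

lemma cycle_pentagon:
  assumes "distinct [a, b, c, d, e]"
    and "{a, b} \<in> E" "{b, c} \<in> E" "{c, d} \<in> E" "{d, e} \<in> E" "{e, a} \<in> E"
  shows "cycle E [a, b, c, d, e]"
  using assms by (simp add: cycle_def All_less_Suc)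

locale maximal_rainbow_matching =
  fixes r n :: nat and V :: "'a set" and E :: "'a set set" and F :: "nat \<Rightarrow> 'a set set"
    and M :: "'a set set" and c :: "'a set \<Rightarrow> nat"
  assumes r_pos: "r \<ge> 1"
    and uniform: "uniform_hypergraph r V E"
    and family: "matching_family E n F"
    and matching: "matching E M"
    and inj_c: "inj_on c M"
    and c_mem: "\<And>x. x \<in> M \<Longrightarrow> c x \<in> {1..n} \<and> x \<in> F (c x)"
    and maximal: "\<And>M'. rainbow_matching E n F M' \<Longrightarrow> card M' \<le> card M"
begin

definition U where "U = {1..n} - c ` M"
definition X where "X = \<Union>M"
definition C where "C p = {j\<in>U. \<exists>f\<in>F j. f \<inter> X = {p}}"

lemma finite_E: "finite E"
proof -
  have "E \<subseteq> Pow V" using uniform by (auto simp: uniform_hypergraph_def)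
  then show ?thesis using uniform by (auto simp: uniform_hypergraph_def intro: finite_subset)
qed

lemma edge: assumes "e \<in> E" shows "finite e" "card e = r" "e \<noteq> {}"
proof -
  show "finite e" "card e = r"
    using uniform assms by (auto simp: uniform_hypergraph_def intro: finite_subset)
  then show "e \<noteq> {}" using r_pos by auto
qed

lemma M_sub: "M \<subseteq> E" and disjoint_M: "disjoint M"
  using matching by (auto simp: matching_def)

lemma finite_M: "finite M"
  using M_sub finite_E finite_subset by blast

lemma finite_U [simp]: "finite U" by (simp add: U_def)

lemma finite_C [simp]: "finite (C p)" by (simp add: C_def)

lemma card_C_le: "card (C p) \<le> card U"
  by (rule card_mono) (auto simp: C_def)

lemma card_U: "n = card M + card U"
proof -
  have "c ` M \<subseteq> {1..n}" using c_mem by auto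
  then have "card U = n - card M" "card M \<le> n"
    using card_image[OF inj_c] card_mono[of "{1..n}" "c ` M"]
    by (auto simp: U_def card_Diff_subset finite_subset)
  then show ?thesis by simp
qed

lemma F_prop: assumes "j \<in> U"
  shows "F j \<subseteq> E" "disjoint (F j)" "card (F j) = n" "finite (F j)"
proof -
  show "F j \<subseteq> E" "disjoint (F j)" "card (F j) = n"
    using family assms by (auto simp: matching_family_def matching_def U_def)
  then show "finite (F j)" using finite_E finite_subset by blast
qed

lemma finite_X [simp]: "finite X"
  using finite_M edge(1) M_sub unfolding X_def by blast

lemma card_X: "card X = r * card M"
proof -
  have "card X = (\<Sum>e\<in>M. card e)"
    unfolding X_def using disjoint_M edge M_sub
    by (intro card_Union_disjoint) (auto simp: disjoint_def pairwise_def disjnt_def)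
  also have "\<dots> = (\<Sum>e\<in>M. r)" using M_sub edge by (intro sum.cong) auto
  finally show ?thesis by simp
qed

section \<open>Exchange arguments\<close>

lemma exchange:
  assumes D: "D \<subseteq> M" and A: "finite A" "inj_on d A" "disjoint A"
    and d: "\<And>x. x \<in> A \<Longrightarrow> d x \<in> U \<and> x \<in> F (d x)"
    and dis: "\<And>x y. x \<in> A \<Longrightarrow> y \<in> M - D \<Longrightarrow> x \<inter> y = {}"
  shows "card A \<le> card D"
proof -
  define M' where "M' = (M - D) \<union> A"
  define c' where "c' x = (if x \<in> A then d x else c x)" for x
  have AE: "A \<subseteq> E" using d F_prop by blast
  have AM: "(M - D) \<inter> A = {}"
  proof -
    \<comment> \<open>An edge of \<open>A\<close> that is also kept from \<open>M\<close> would be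
      disjoint from itself, hence empty.\<close>
    have "x \<notin> A" if "x \<in> M - D" for x using that dis[of x x] edge(3)[of x] M_sub by auto
    then show ?thesis by blast
  qed
  have "disjoint M'"
    unfolding M'_def disjoint_def
  proof (intro ballI impI)
    fix a b assume "a \<in> M - D \<union> A" "b \<in> M - D \<union> A" "a \<noteq> b"
    then show "a \<inter> b = {}"
      using dis[of a b] dis[of b a] disjoint_M A(3) unfolding disjoint_def by blast
  qed
  then have "matching E M'" using AE M_sub by (auto simp: matching_def M'_def)
  moreover have "inj_on c' M'"
  proof (rule inj_onI)
    have "c x \<noteq> d y" if "x \<in> M" "y \<in> A" for x y
      using that d[of y] unfolding U_def by (metis DiffD2 imageI)
    then have ne: "d y \<noteq> c x" "c x \<noteq> d y" if "x \<in> M" "y \<in> A" for x y using that by metis+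
    fix x y assume "x \<in> M'" "y \<in> M'" "c' x = c' y"
    then show "x = y"
      using A(2) inj_c ne unfolding M'_def c'_def by (auto split: if_splits dest: inj_onD)
  qed
  moreover have "\<forall>x\<in>M'. c' x \<in> {1..n} \<and> x \<in> F (c' x)"
    using c_mem d unfolding M'_def c'_def U_def by auto
  ultimately have "card M' \<le> card M" by (intro maximal) (auto simp: rainbow_matching_def)
  moreover have "card M' = card M - card D + card A"
    unfolding M'_def using finite_M A(1) AM D
    by (simp add: card_Un_disjoint card_Diff_subset finite_subset)
  moreover have "card D \<le> card M" using D finite_M card_mono by blast
  ultimately show ?thesis by simp
qed

lemma meets_X: assumes "j \<in> U" "f \<in> F j" shows "f \<inter> X \<noteq> {}"
proof
  assume "f \<inter> X = {}"
  then have "card {f} \<le> card ({} :: 'a set set)"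
    using assms by (intro exchange[where d = "\<lambda>_. j"]) (auto simp: X_def disjoint_def)
  then show False by simp
qed

text \<open>Otherwise \<open>e\<close> could be replaced by \<open>f\<close> and \<open>g\<close>,
  which touch no other edge of \<open>M\<close>.\<close>

lemma one_two_exchange:
  assumes "e \<in> M" "p \<in> e" "q \<in> e" "p \<noteq> q" "j \<in> U" "k \<in> U" "j \<noteq> k"
    and "f \<in> F j" "f \<inter> X = {p}" "g \<in> F k" "g \<inter> X = {q}"
  shows "f \<inter> g \<noteq> {}"
proof
  assume fg: "f \<inter> g = {}"
  have ne: "f \<noteq> g" using assms by auto
  have oth: "p \<notin> y" "q \<notin> y" if "y \<in> M" "y \<noteq> e" for y
    using that assms(1-3) disjoint_M unfolding disjoint_def by blast+
  have "card {f, g} \<le> card {e}"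
  proof (rule exchange[where d = "\<lambda>x. if x = f then j else k"])
    show "disjoint {f, g}" using fg by (auto simp: disjoint_def)
    fix x y assume "x \<in> {f, g}" "y \<in> M - {e}"
    moreover have "x \<inter> y = (x \<inter> X) \<inter> y" using \<open>y \<in> M - {e}\<close> by (auto simp: X_def)
    ultimately show "x \<inter> y = {}" using oth[of y] assms(9,11) by auto
  qed (use assms ne in auto)
  then show False using ne by simp
qed

text \<open>Otherwise \<open>e\<close> and \<open>e'\<close> could be replaced by the three edges
  \<open>{v, v'}\<close>, \<open>f\<close> and \<open>g\<close>.\<close>

lemma two_three_exchange:
  assumes M: "e \<in> M" "e' \<in> M" "e \<noteq> e'" "u \<in> e" "v \<in> e" "u' \<in> e'" "v' \<in> e'" "u \<noteq> v" "u' \<noteq> v'"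
    and col: "j \<in> U" "a \<in> U" "b \<in> U" "j \<noteq> a" "j \<noteq> b" "a \<noteq> b"
    and h: "{v, v'} \<in> F j" and f: "f \<in> F a" "f \<inter> X = {u}" and g: "g \<in> F b" "g \<inter> X = {u'}"
  shows "f \<inter> g \<noteq> {}"
proof
  assume fg: "f \<inter> g = {}"
  have ee: "e \<inter> e' = {}" using M disjoint_M by (auto simp: disjoint_def)
  have X: "e \<subseteq> X" "e' \<subseteq> X" using M by (auto simp: X_def)
  have hf: "{v, v'} \<inter> f = {}" "{v, v'} \<inter> g = {}"
  proof -
    have "{v, v'} \<subseteq> X" using M X by blast
    then have "{v, v'} \<inter> f = {v, v'} \<inter> (f \<inter> X)" "{v, v'} \<inter> g = {v, v'} \<inter> (g \<inter> X)" by blast+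
    moreover have "u \<notin> {v, v'}" "u' \<notin> {v, v'}" using M ee by auto
    ultimately show "{v, v'} \<inter> f = {}" "{v, v'} \<inter> g = {}" using f(2) g(2) by simp_all
  qed
  have ne: "f \<noteq> g" "{v, v'} \<noteq> f" "{v, v'} \<noteq> g"
    using fg hf f(2) by (metis Int_absorb Int_empty_left empty_not_insert)+
  have oth: "{u, v, u', v'} \<inter> y = {}" if "y \<in> M" "y \<noteq> e" "y \<noteq> e'" for y
  proof -
    have "e \<inter> y = {}" "e' \<inter> y = {}" using that M disjoint_M by (auto simp: disjoint_def)
    then show ?thesis using M by auto
  qed
  have "card {{v, v'}, f, g} \<le> card {e, e'}"
  proof (rule exchange[where d = "\<lambda>x. if x = f then a else if x = g then b else j"])
    show "disjoint {{v, v'}, f, g}"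
      using fg hf unfolding disjoint_def by blast
    show "inj_on (\<lambda>x. if x = f then a else if x = g then b else j) {{v, v'}, f, g}"
      using col ne by (auto simp: inj_on_def)
    fix x y assume x: "x \<in> {{v, v'}, f, g}" and y: "y \<in> M - {e, e'}"
    have "x \<inter> X \<subseteq> {u, v, u', v'}" using x f(2) g(2) by blast
    moreover have "y \<subseteq> X" using y by (auto simp: X_def)
    ultimately show "x \<inter> y = {}" using oth[of y] y by blast
  qed (use M col h f g ne in auto)
  then show False using ne M by simp
qed

text \<open>Every edge of \<open>F j\<close> meets \<open>X\<close>. Its number of points in
  \<open>X\<close>, increased by one if that number is 1, is therefore at least 2; the increments
  are paid for by distinct vertices that have colour \<open>j\<close>.\<close>

lemma count_colour:
  assumes "j \<in> U"
  shows "2 * n \<le> r * card M + card {p\<in>X. j \<in> C p}"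
proof -
  define S where "S = {f\<in>F j. card (f \<inter> X) = 1}"
  note F = F_prop[OF assms]
  have "(\<Sum>f\<in>F j. card (f \<inter> X)) = card (\<Union>f\<in>F j. f \<inter> X)"
    using F by (subst card_UN_disjoint) (auto simp: disjoint_def)
  also have "\<dots> \<le> card X" by (rule card_mono) auto
  finally have 1: "(\<Sum>f\<in>F j. card (f \<inter> X)) \<le> r * card M" by (simp add: card_X)
  have 2: "card S \<le> card {p\<in>X. j \<in> C p}"
  proof -
    have "\<exists>p. f \<inter> X = {p}" if "f \<in> S" for f
      using that unfolding S_def by (auto simp: card_1_singleton_iff)
    then obtain p where p: "\<And>f. f \<in> S \<Longrightarrow> f \<inter> X = {p f}" by metis
    then have pf: "p f \<in> f" "p f \<in> X" "f \<in> F j" if "f \<in> S" for f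
      using that by (auto simp: S_def)
    have "inj_on p S"
    proof (rule inj_onI)
      fix f g assume "f \<in> S" "g \<in> S" "p f = p g"
      then have "p f \<in> f \<inter> g" "f \<in> F j" "g \<in> F j" using pf[of f] pf[of g] by simp_all
      then show "f = g" using F(2) unfolding disjoint_def by blast
    qed
    moreover have "p ` S \<subseteq> {p \<in> X. j \<in> C p}"
    proof (rule image_subsetI)
      fix f assume "f \<in> S"
      then show "p f \<in> {p \<in> X. j \<in> C p}" using p[of f] pf[of f] assms unfolding C_def by blast
    qed
    ultimately show ?thesis by (rule card_inj_on_le) simp
  qed
  have "2 * n = (\<Sum>f\<in>F j. 2)" using F by simp
  also have "\<dots> \<le> (\<Sum>f\<in>F j. card (f \<inter> X) + (if card (f \<inter> X) = 1 then 1 else 0))"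
  proof (rule sum_mono)
    fix f assume "f \<in> F j"
    then have "card (f \<inter> X) \<noteq> 0" using meets_X assms by auto
    then show "2 \<le> card (f \<inter> X) + (if card (f \<inter> X) = 1 then 1 else 0)" by presburger
  qed
  also have "\<dots> = (\<Sum>f\<in>F j. card (f \<inter> X)) + card S"
    using F by (simp add: sum.distrib S_def sum.If_cases Int_def)
  finally show ?thesis using 1 2 by simp
qed

lemma sum_C:
  assumes "A \<subseteq> X"
  shows "(\<Sum>p\<in>A. card (C p)) = (\<Sum>j\<in>U. card {p\<in>A. j \<in> C p})"
proof -
  have "(\<Sum>p\<in>A. card (C p)) = (\<Sum>p\<in>A. card {j\<in>U. j \<in> C p})"
    by (intro sum.cong refl arg_cong[where f = card]) (auto simp: C_def)
  also have "\<dots> = (\<Sum>j\<in>U. card {p\<in>A. j \<in> C p})"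
    using sum.swap_restrict[of A U "\<lambda>_ _. 1::nat" "\<lambda>p j. j \<in> C p"] assms finite_subset[OF assms]
    by simp
  finally show ?thesis .
qed

lemma count:
  "card U * (2 * n) \<le> card U * (r * card M) + (\<Sum>e\<in>M. \<Sum>p\<in>e. card (C p))"
proof -
  have "card U * (2 * n) \<le> (\<Sum>j\<in>U. r * card M + card {p\<in>X. j \<in> C p})"
    using sum_mono[of U "\<lambda>_. 2 * n", OF count_colour] by simp
  also have "\<dots> = card U * (r * card M) + (\<Sum>p\<in>X. card (C p))"
    by (simp add: sum.distrib sum_C)
  also have "(\<Sum>p\<in>X. card (C p)) = (\<Sum>e\<in>M. \<Sum>p\<in>e. card (C p))"
    unfolding X_def using disjoint_M edge M_sub
    by (subst sum.Union_disjoint) (auto simp: disjoint_def)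
  finally show ?thesis .
qed

section \<open>The bound for uniform hypergraphs\<close>

text \<open>Fix one such colour \<open>j\<close> and two vertices \<open>u\<close>, \<open>w\<close>
  of \<open>e\<close>. The edge of any other such colour at \<open>w\<close> meets the edge of
  \<open>j\<close> at \<open>u\<close> in one of its \<open>r - 1\<close> points outside
  \<open>X\<close>, and different colours use different points.\<close>

lemma card_full_colours:
  assumes "r \<ge> 2" "e \<in> M"
  shows "card {j\<in>U. \<forall>p\<in>e. j \<in> C p} \<le> r" (is "card ?B \<le> r")
proof (cases "?B = {}")
  case True
  then show ?thesis by (simp only: card.empty)
next
  case False
  then obtain j where j: "j \<in> ?B" by auto
  obtain h where h: "\<And>k p. k \<in> C p \<Longrightarrow> h k p \<in> F k \<and> h k p \<inter> X = {p}"
  proof -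
    have "\<exists>f. k \<in> C p \<longrightarrow> f \<in> F k \<and> f \<inter> X = {p}" for k p by (auto simp: C_def)
    then show ?thesis using that by metis
  qed
  have hB: "h k p \<in> F k" "h k p \<inter> X = {p}" "p \<in> h k p" "k \<in> U" "h k p \<in> E"
    if "k \<in> ?B" "p \<in> e" for k p
    using h[of k p] that F_prop(1)[of k] by auto
  have e: "finite e" "card e = r" "e \<subseteq> X" using edge[of e] assms M_sub by (auto simp: X_def)
  obtain u w where uw: "u \<in> e" "w \<in> e" "u \<noteq> w"
    using assms(1) e card_le_Suc0_iff_eq[of e] by auto
  have ex: "\<exists>x. x \<in> h j u \<inter> h k w" if "k \<in> ?B - {j}" for k
    using one_two_exchange[of e u w j k "h j u" "h k w"] that j hB uw assms(2) by blast
  define x where "x k = (SOME x. x \<in> h j u \<inter> h k w)" for k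
  have x: "x k \<in> h j u \<inter> h k w" if "k \<in> ?B - {j}" for k
    unfolding x_def by (rule someI_ex[OF ex[OF that]])
  \<comment> \<open>The two edges meet \<open>X\<close> only in \<open>u\<close> and only in
    \<open>w\<close>, so a common point lies outside \<open>X\<close>.\<close>
  have xX: "x k \<notin> X" if "k \<in> ?B - {j}" for k
  proof
    assume "x k \<in> X"
    then have "x k = u" "x k = w" using x[OF that] hB(2)[of j u] hB(2)[of k w] that j uw by blast+
    then show False using uw by simp
  qed
  have "inj_on x (?B - {j})"
  proof (rule inj_onI, rule ccontr)
    fix k l assume kl: "k \<in> ?B - {j}" "l \<in> ?B - {j}" "x k = x l" "k \<noteq> l"
    \<comment> \<open>If \<open>k\<close> and \<open>l\<close> had the same point, the
      \<open>r\<close> pairwise disjoint edges \<open>h k s\<close>, one for each \<open>s\<close>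
      in \<open>e\<close>, would all meet \<open>?H\<close>, which has only \<open>r - 1\<close>
      points.\<close>
    let ?H = "h l w - {w}"
    have fin: "finite ?H" "card ?H = r - 1" using hB[of l w] edge[of "h l w"] kl uw by auto
    have meet: "h k s \<inter> ?H \<noteq> {}" if s: "s \<in> e" for s
    proof (cases "s = w")
      case True
      \<comment> \<open>No exchange applies at \<open>w\<close> itself, but the shared point serves:
        it lies outside \<open>X\<close> and so differs from \<open>w\<close>.\<close>
      have "x k \<in> h k w \<inter> h l w" using x[OF kl(1)] x[OF kl(2)] kl(3) by auto
      then show ?thesis using True xX[OF kl(1)] uw e by blast
    next
      case False
      then have "h k s \<inter> h l w \<noteq> {}"
        using s uw kl by (intro one_two_exchange[OF assms(2) s uw(2) False _ _ kl(4) hB(1,2) hB(1,2)]) auto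
      moreover have "w \<notin> h k s"
      proof
        assume "w \<in> h k s"
        then have "w \<in> h k s \<inter> X" using uw e by blast
        moreover have "h k s \<inter> X = {s}" using hB(2)[of k s] kl s by blast
        ultimately have "w \<in> {s}" by metis
        then show False using False by simp
      qed
      ultimately show ?thesis by blast
    qed
    have dis: "h k s \<inter> h k t = {}" if "s \<in> e" "t \<in> e" "s \<noteq> t" for s t
    proof -
      have "h k s \<inter> X = {s}" "h k t \<inter> X = {t}"
        using hB(2)[of k s] hB(2)[of k t] kl that by blast+
      then have "h k s \<noteq> h k t" using \<open>s \<noteq> t\<close> by (metis singleton_inject)
      moreover have "k \<in> U" "h k s \<in> F k" "h k t \<in> F k" using hB(1,4)[of k] that kl by auto
      ultimately show ?thesis using F_prop(2)[of k] unfolding disjoint_def by blast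
    qed
    have "r = (\<Sum>s\<in>e. 1)" using e by simp
    also have "\<dots> \<le> (\<Sum>s\<in>e. card (h k s \<inter> ?H))"
    proof (rule sum_mono)
      fix s assume "s \<in> e"
      then show "1 \<le> card (h k s \<inter> ?H)" using meet[of s] fin(1) by (simp add: Suc_le_eq card_gt_0_iff)
    qed
    also have "\<dots> = card (\<Union>s\<in>e. h k s \<inter> ?H)"
    proof (rule card_UN_disjoint[symmetric])
      show "\<forall>s\<in>e. \<forall>t\<in>e. s \<noteq> t \<longrightarrow> (h k s \<inter> ?H) \<inter> (h k t \<inter> ?H) = {}"
        using dis by blast
    qed (use fin e in auto)
    also have "\<dots> \<le> card ?H" using fin by (intro card_mono) auto
    finally show False using fin assms by simp
  qed
  moreover have "x ` (?B - {j}) \<subseteq> h j u - {u}" using x xX uw e by blast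
  ultimately have "card (?B - {j}) \<le> card (h j u - {u})"
    using edge(1)[OF hB(5)[OF j uw(1)]] by (intro card_inj_on_le[where f = x]) simp_all
  also have "\<dots> = r - 1"
    using edge(2)[OF hB(5)[OF j uw(1)]] hB(3)[OF j uw(1)] by (simp add: card_Diff_singleton)
  finally have "card (?B - {j}) \<le> r - 1" .
  moreover have "card (?B - {j}) = card ?B - 1" using j by (rule card_Diff_singleton)
  ultimately show ?thesis using assms(1) by linarith
qed

text \<open>A colour that is absent from some vertex of \<open>e\<close> accounts for at most
  \<open>r - 1\<close> pairs. The remaining colours account for one more each, and there are at most
  \<open>r\<close> of them.\<close>

lemma sum_edge_le:
  assumes "r \<ge> 2" "e \<in> M"
  shows "(\<Sum>p\<in>e. card (C p)) \<le> (r - 1) * card U + r"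
proof -
  let ?P = "\<lambda>j. \<forall>p\<in>e. j \<in> C p"
  have e: "finite e" "card e = r" "e \<subseteq> X" using edge[of e] assms M_sub by (auto simp: X_def)
  have "(\<Sum>p\<in>e. card (C p)) = (\<Sum>j\<in>U. card {p\<in>e. j \<in> C p})" using e by (intro sum_C)
  also have "\<dots> \<le> (\<Sum>j\<in>U. (r - 1) + (if ?P j then 1 else 0))"
  proof (rule sum_mono)
    fix j
    show "card {p \<in> e. j \<in> C p} \<le> (r - 1) + (if ?P j then 1 else 0)"
    proof (cases "?P j")
      case True
      then show ?thesis using assms e card_mono[of e "{p \<in> e. j \<in> C p}"] by auto
    next
      case False
      then have "{p \<in> e. j \<in> C p} \<subset> e" by auto
      then have "card {p \<in> e. j \<in> C p} < r" using e psubset_card_mono by metis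
      then show ?thesis by simp
    qed
  qed
  also have "\<dots> = (r - 1) * card U + card {j\<in>U. ?P j}"
    by (simp add: sum.distrib sum.If_cases Int_def)
  finally show ?thesis using card_full_colours[OF assms] by simp
qed

lemma uniform_bound:
  assumes "r \<ge> 2"
  shows "real (card M) \<ge> (real n - 1 / 2 - 3 / (4 * real r - 6)) / (real r - 1 / 2)"
proof (rule ccontr)
  define m q R where "m = real (card M)" and "q = real (card U)" and "R = real r"
  assume less: "\<not> ?thesis"
  have R: "R \<ge> 2" using assms by (simp add: R_def)
  have n: "real n = m + q" using card_U by (simp add: m_def q_def)
  have "(\<Sum>e\<in>M. \<Sum>p\<in>e. card (C p)) \<le> card M * ((r - 1) * card U + r)"
    using sum_mono[of M, OF sum_edge_le[OF assms]] by simp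
  then have "card U * (2 * n) \<le> card U * (r * card M) + card M * ((r - 1) * card U + r)"
    using count by simp
  then have "real (card U * (2 * n)) \<le> real (card U * (r * card M) + card M * ((r - 1) * card U + r))"
    by (simp only: of_nat_le_iff)
  then have "q * (2 * (m + q)) \<le> q * (R * m) + m * ((R - 1) * q + R)"
    using assms n by (simp add: m_def q_def R_def of_nat_diff)
  then have 1: "q * (2 * (m + q) - (2 * R - 1) * m) \<le> R * m" by (simp add: algebra_simps)
  have "m * (R - 1 / 2) < real n - 1 / 2 - 3 / (4 * R - 6)"
    using less R by (simp add: m_def R_def pos_less_divide_eq not_le)
  \<comment> \<open>With this identity, doubling the negated claim bounds from below the same factor
    that double counting bounds from above in 1.\<close>
  moreover have "1 / 2 + 3 / (4 * R - 6) = R / (2 * R - 3)" using R by (simp add: field_simps)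
  ultimately have 2: "2 * (m + q) - (2 * R - 1) * m > 2 * R / (2 * R - 3)"
    using n by argo
  have pos: "2 * R / (2 * R - 3) > 0" using R by simp
  have "2 * q > (2 * R - 3) * m" using 2 pos by (simp add: algebra_simps)
  moreover have m0: "(2 * R - 3) * m \<ge> 0" using R by (simp add: m_def)
  ultimately have q: "q > 0" "2 * q \<ge> (2 * R - 3) * m" by linarith+
  \<comment> \<open>The inequality between \<open>q\<close> and \<open>m\<close> turns
    \<open>R * m\<close> into at most a multiple of \<open>q\<close>, which makes 1 and 2
    incompatible.\<close>
  have "R * m = (2 * R - 3) * m * (R / (2 * R - 3))" using R by simp
  also have "\<dots> \<le> 2 * q * (R / (2 * R - 3))" using q R by (intro mult_right_mono) auto
  also have "\<dots> = q * (2 * R / (2 * R - 3))" by simp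
  also have "\<dots> < q * (2 * (m + q) - (2 * R - 1) * m)"
    by (rule mult_strict_left_mono[OF 2 q(1)])
  finally show False using 1 by simp
qed

section \<open>Hubs and leaves in graphs\<close>

lemma hub_bound:
  assumes r: "r = 2"
    and hub: "\<And>p p'. {p, p'} \<in> M \<Longrightarrow> p \<noteq> p' \<Longrightarrow> C p \<noteq> {} \<Longrightarrow> C p' \<noteq> {} \<Longrightarrow>
      card (C p) + card (C p') \<le> t"
    and leaves: "\<And>j u v u' v'. {u, v} \<in> M \<Longrightarrow> {u', v'} \<in> M \<Longrightarrow> distinct [u, v, u', v'] \<Longrightarrow>
      card (C u) > t \<Longrightarrow> card (C u') > t \<Longrightarrow> j \<in> U \<Longrightarrow> {v, v'} \<notin> F j"
  shows "card U \<le> t \<or> 3 * card U \<le> card M + t"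
proof (rule disjCI)
  assume "\<not> 3 * card U \<le> card M + t"
  define G where "G = {e\<in>M. (\<Sum>p\<in>e. card (C p)) > t}"
  have GM: "G \<subseteq> M" by (auto simp: G_def)
  have "\<exists>u v. e = {u, v} \<and> u \<noteq> v \<and> card (C u) > t \<and> C v = {}" if "e \<in> G" for e
  proof -
    have "card e = 2" using that GM M_sub edge r by blast
    then obtain a b where ab: "e = {a, b}" "a \<noteq> b" by (auto simp: card_2_iff)
    then have s: "card (C a) + card (C b) > t" "{a, b} \<in> M" using that by (auto simp: G_def)
    \<comment> \<open>If both ends had colours, \<open>hub\<close> would cap the sum at
      \<open>t\<close>.\<close>
    then have "C a = {} \<or> C b = {}" using hub[of a b] ab by fastforce
    then show ?thesis using ab s by (metis add.commute add_0 card.empty insert_commute)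
  qed
  then obtain u v where uv: "\<And>e. e \<in> G \<Longrightarrow> e = {u e, v e} \<and> u e \<noteq> v e \<and> card (C (u e)) > t \<and> C (v e) = {}"
    by metis
  have dis: "e \<inter> e' = {}" if "e \<in> G" "e' \<in> G" "e \<noteq> e'" for e e'
    using that GM disjoint_M by (auto simp: disjoint_def)
  have "inj_on v G"
  proof (rule inj_onI, rule ccontr)
    fix e e' assume e: "e \<in> G" "e' \<in> G" "v e = v e'" "e \<noteq> e'"
    have "v e \<in> e" "v e' \<in> e'" using uv e(1,2) by blast+
    then show False using dis[of e e'] e by auto
  qed
  then have cL: "card (v ` G) = card G" by (rule card_image)
  have LX: "v ` G \<subseteq> X" using uv GM unfolding X_def by blast
  have "card G \<le> card M" using GM finite_M card_mono by blast
  have sG: "(\<Sum>p\<in>e. card (C p)) \<le> card U" if "e \<in> G" for e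
  proof -
    have "(\<Sum>p\<in>{u e, v e}. card (C p)) = card (C (u e))"
    proof -
      have "u e \<noteq> v e" "C (v e) = {}" using uv[OF that] by blast+
      then show ?thesis by simp
    qed
    moreover have "e = {u e, v e}" using uv[OF that] by blast
    ultimately have "(\<Sum>p\<in>e. card (C p)) = card (C (u e))" by metis
    then show ?thesis using card_C_le by simp
  qed
  have "(\<Sum>e\<in>M. \<Sum>p\<in>e. card (C p)) =
    (\<Sum>e\<in>M - G. \<Sum>p\<in>e. card (C p)) + (\<Sum>e\<in>G. \<Sum>p\<in>e. card (C p))"
    using GM finite_M by (rule sum.subset_diff)
  also have "\<dots> \<le> (\<Sum>e\<in>M - G. t) + (\<Sum>e\<in>G. card U)"
    using sG by (intro add_mono sum_mono) (auto simp: G_def)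
  also have "\<dots> = (card M - card G) * t + card G * card U"
    using GM finite_M by (simp add: card_Diff_subset finite_subset)
  finally have 1: "card U * (2 * n) \<le> card U * (2 * card M) + ((card M - card G) * t + card G * card U)"
    using count r by simp
  show "card U \<le> t"
  proof (rule ccontr)
    assume q: "\<not> card U \<le> t"
    then obtain j where j: "j \<in> U" by fastforce
    note Fj = F_prop[OF j]
    \<comment> \<open>An edge of \<open>F j\<close> meeting \<open>X\<close> only in leaves would
      either give colour \<open>j\<close> to a single leaf or join two leaves, against
      \<open>leaves\<close>.\<close>
    have meet: "f \<inter> (X - v ` G) \<noteq> {}" if f: "f \<in> F j" for f
    proof
      assume a: "f \<inter> (X - v ` G) = {}"
      obtain x where x: "x \<in> f" "x \<in> X" using meets_X[OF j f] by auto
      then obtain e where e: "e \<in> G" "x = v e" using a by auto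
      have "card f = 2" using Fj f edge r by blast
      then obtain y where y: "f = {v e, y}" "v e \<noteq> y"
        using x e by (auto simp: card_2_iff)
      show False
      proof (cases "y \<in> X")
        case False
        then have "f \<inter> X = {v e}" using x y e by auto
        then have "j \<in> C (v e)" using j f by (auto simp: C_def)
        then show False using uv e by blast
      next
        case True
        then obtain e' where e': "e' \<in> G" "y = v e'" using a y by auto
        then have "e \<noteq> e'" using y by auto
        then have "distinct [u e, v e, u e', v e']" using dis[of e e'] uv[of e] uv[of e'] e e' by auto
        then show False
          using leaves[of "u e" "v e" "u e'" "v e'" j] uv[of e] uv[of e'] e e' GM j f y by auto
      qed
    qed
    \<comment> \<open>The \<open>n\<close> disjoint edges of \<open>F j\<close> need distinct
      vertices among the \<open>2 * card M - card G\<close> that are not leaves.\<close>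
    have "n = (\<Sum>f\<in>F j. 1)" using Fj by simp
    also have "\<dots> \<le> (\<Sum>f\<in>F j. card (f \<inter> (X - v ` G)))"
      using meet by (intro sum_mono) (simp add: Suc_le_eq card_gt_0_iff)
    also have "\<dots> = card (\<Union>f\<in>F j. f \<inter> (X - v ` G))"
      using Fj by (subst card_UN_disjoint) (auto simp: disjoint_def)
    also have "\<dots> \<le> card (X - v ` G)" by (rule card_mono) auto
    also have "\<dots> = 2 * card M - card G"
      using LX card_X r cL by (simp add: card_Diff_subset finite_subset)
    finally have 2: "card G + card U \<le> card M" using card_U \<open>card G \<le> card M\<close> by simp
    have n: "int n = int (card M) + int (card U)" using card_U by linarith
    \<comment> \<open>Over the integers the subtractions below are not truncated.\<close>
    define m q g s where "m = int (card M)" and "q = int (card U)" and "g = int (card G)" and "s = int t"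
    have "int (card U * (2 * n)) \<le> int (card U * (2 * card M) + ((card M - card G) * t + card G * card U))"
      using 1 by (simp only: of_nat_le_iff)
    then have "q * (2 * (m + q)) \<le> q * (2 * m) + ((m - g) * s + g * q)"
      using \<open>card G \<le> card M\<close> by (simp add: m_def q_def g_def s_def of_nat_diff flip: n)
    then have 3: "2 * q * q \<le> m * s + g * (q - s)" by (simp add: algebra_simps)
    have "q > s" using q by (simp add: q_def s_def)
    moreover have "g \<le> m - q" using 2 by (simp add: m_def q_def g_def)
    \<comment> \<open>Since \<open>q > s\<close>, the right side of 3 increases with
      \<open>g\<close>, so \<open>g\<close> may be replaced by its upper bound
      \<open>m - q\<close>.\<close>
    ultimately have "g * (q - s) \<le> (m - q) * (q - s)" by (intro mult_right_mono) auto
    then have "q * (3 * q) \<le> q * (m + s)" using 3 by (simp add: algebra_simps)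
    moreover have "q > 0" using \<open>q > s\<close> by (simp add: s_def)
    ultimately have "3 * q \<le> m + s" by simp
    then show False using \<open>\<not> 3 * card U \<le> card M + t\<close> by (simp add: m_def q_def s_def)
  qed
qed

lemma C_E:
  assumes "j \<in> C p" "r = 2"
  obtains x where "{p, x} \<in> F j" "x \<notin> X" "{p, x} \<inter> X = {p}" "{p, x} \<in> E" "p \<noteq> x" "j \<in> U"
proof -
  obtain f where f: "f \<in> F j" "f \<inter> X = {p}" "j \<in> U" using assms by (auto simp: C_def)
  then have "card f = 2" "f \<in> E" using F_prop edge assms by blast+
  then obtain a b where ab: "f = {a, b}" "a \<noteq> b" by (auto simp: card_2_iff)
  moreover have "p \<in> {a, b}" using f(2) ab by blast
  ultimately obtain x where "f = {p, x}" "p \<noteq> x" by (metis empty_iff insert_commute insert_iff)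
  moreover from this f(2) have "x \<notin> X" by auto
  ultimately show ?thesis using f that[of x] \<open>f \<in> E\<close> by simp
qed

lemma exists_other_colour:
  assumes "card (C p) > card A" "finite A"
  obtains j where "j \<in> C p" "j \<notin> A"
proof -
  have "\<not> C p \<subseteq> A" using assms card_mono[of A "C p"] by auto
  then show ?thesis using that by blast
qed

text \<open>By the exchange argument the two edges meet, and they cannot meet in \<open>X\<close>,
  where their points \<open>p\<close> and \<open>p'\<close> differ.\<close>

lemma distinct_colours_same_end:
  assumes "r = 2" "{p, p'} \<in> M" "p \<noteq> p'" "j \<noteq> k"
    and "{p, x} \<in> F j" "{p, x} \<inter> X = {p}" "j \<in> U" "{p', y} \<in> F k" "{p', y} \<inter> X = {p'}" "k \<in> U"
  shows "x = y"
proof -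
  have "{p, x} \<inter> {p', y} \<noteq> {}"
    using assms one_two_exchange[of "{p, p'}" p p' j k "{p, x}" "{p', y}"] by auto
  moreover have "p' \<in> X" "p \<in> X" using assms(2) by (auto simp: X_def)
  then have "p' \<noteq> x" "p \<noteq> y" using assms(3,6,9) by (metis IntI insert_iff singletonD)+
  ultimately show ?thesis using assms(3) by auto
qed

section \<open>Graphs without cycles of length 3 and 5\<close>

lemma no_C3_C5_bound:
  assumes r: "r = 2"
    and C3: "\<not> (\<exists>vs. cycle E vs \<and> length vs = 3)" and C5: "\<not> (\<exists>vs. cycle E vs \<and> length vs = 5)"
  shows "card U \<le> 2 \<or> 3 * card U \<le> card M + 2"
proof (rule hub_bound[OF r])
  fix p p' assume M: "{p, p'} \<in> M" "p \<noteq> p'" and ne: "C p \<noteq> {}" "C p' \<noteq> {}"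
  have same: "j = k" if jk: "j \<in> C p" "k \<in> C p'" for j k
  proof (rule ccontr)
    assume "j \<noteq> k"
    obtain x where x: "{p, x} \<in> F j" "x \<notin> X" "{p, x} \<inter> X = {p}" "{p, x} \<in> E" "p \<noteq> x" "j \<in> U"
      using jk r by (elim C_E)
    obtain y where y: "{p', y} \<in> F k" "y \<notin> X" "{p', y} \<inter> X = {p'}" "{p', y} \<in> E" "p' \<noteq> y" "k \<in> U"
      using jk r by (elim C_E)
    have "x = y" using distinct_colours_same_end[OF r M \<open>j \<noteq> k\<close>] x y by blast
    have "p \<in> X" "p' \<in> X" using M by (auto simp: X_def)
    then have "distinct [p, p', x]" using M(2) x(2) by auto
    moreover have "{p, p'} \<in> E" "{p', x} \<in> E" "{x, p} \<in> E"
      using M M_sub x(4) y(4) \<open>x = y\<close> by (auto simp: insert_commute)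
    ultimately have "cycle E [p, p', x]" by (intro cycle_triangle)
    then show False using C3 by force
  qed
  obtain j where "j \<in> C p" using ne by auto
  moreover obtain k where "k \<in> C p'" using ne by auto
  ultimately have "C p \<subseteq> {k}" "C p' \<subseteq> {j}" using same by blast+
  then show "card (C p) + card (C p') \<le> 2"
    using card_mono[of "{k}" "C p"] card_mono[of "{j}" "C p'"] by simp
next
  fix j u v u' v'
  assume M: "{u, v} \<in> M" "{u', v'} \<in> M" and dist: "distinct [u, v, u', v']"
    and big: "card (C u) > 2" "card (C u') > 2" and j: "j \<in> U"
  show "{v, v'} \<notin> F j"
  proof
    assume h: "{v, v'} \<in> F j"
    \<comment> \<open>The exchange needs three different colours; more than two colours at each hub
      allow \<open>a\<close> to avoid \<open>j\<close>, and \<open>b\<close> to avoid both.\<close>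
    have "card {j} < card (C u)" using big by simp
    then obtain a where a: "a \<in> C u" "a \<notin> {j}" by (elim exists_other_colour) auto
    have "card {j, a} < card (C u')" using big card_insert_le_m1[of 2 "{a}" j] by simp
    then obtain b where b: "b \<in> C u'" "b \<notin> {j, a}" by (elim exists_other_colour) auto
    obtain x where x: "{u, x} \<in> F a" "x \<notin> X" "{u, x} \<inter> X = {u}" "{u, x} \<in> E" "u \<noteq> x" "a \<in> U"
      using a r by (elim C_E)
    obtain y where y: "{u', y} \<in> F b" "y \<notin> X" "{u', y} \<inter> X = {u'}" "{u', y} \<in> E" "u' \<noteq> y" "b \<in> U"
      using b r by (elim C_E)
    have "{u, x} \<inter> {u', y} \<noteq> {}"
      using two_three_exchange[of "{u, v}" "{u', v'}" u v u' v' j a b] M dist j a b h x y by auto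
    moreover have X: "u \<in> X" "v \<in> X" "u' \<in> X" "v' \<in> X" using M by (auto simp: X_def)
    ultimately have "x = y" using dist x y by auto
    moreover have "{v, v'} \<in> E" using F_prop(1)[OF j] h by auto
    moreover have "{u, v} \<in> E" "{u', v'} \<in> E" using M M_sub by auto
    moreover have "distinct [v, u, x, u', v']" using X x dist by auto
    ultimately have "cycle E [v, u, x, u', v']"
      using x(4) y(4) by (intro cycle_pentagon) (simp_all add: insert_commute)
    then show False using C5 by force
  qed
qed

section \<open>Pairwise disjoint matchings\<close>

text \<open>Now an edge determines its colour, so forcing two colours onto one edge replaces the
  forbidden cycles. Here \<open>t = 4\<close>, two colours for each end.\<close>

lemma disjoint_bound:
  assumes r: "r = 2" and disj: "disjoint_family_on F {1..n}"
  shows "card U \<le> 4 \<or> 3 * card U \<le> card M + 4"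
proof -
  have colour_unique: "i = k" if "f \<in> F i" "f \<in> F k" "i \<in> U" "k \<in> U" for f i k
    using disj that unfolding disjoint_family_on_def U_def by blast
  have two: "card (C p) \<le> 2" if M: "{p, p'} \<in> M" "p \<noteq> p'" and ne: "C p' \<noteq> {}" for p p'
  proof (rule ccontr)
    assume big: "\<not> card (C p) \<le> 2"
    obtain k where "k \<in> C p'" using ne by auto
    then obtain y where y: "{p', y} \<in> F k" "{p', y} \<inter> X = {p'}" "k \<in> U" using r by (elim C_E)
    have "card {k} < card (C p)" using big by simp
    then obtain i where i: "i \<in> C p" "i \<notin> {k}" by (elim exists_other_colour) auto
    have "card {k, i} < card (C p)" using big card_insert_le_m1[of 2 "{i}" k] by simp
    then obtain l where l: "l \<in> C p" "l \<notin> {k, i}" by (elim exists_other_colour) auto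
    \<comment> \<open>Every colour at \<open>p\<close> other than \<open>k\<close> has its edge
      ending in \<open>y\<close>, so \<open>i\<close> and \<open>l\<close> would share the edge
      \<open>{p, y}\<close>.\<close>
    have "{p, y} \<in> F a \<and> a \<in> U" if a: "a \<in> C p" "a \<noteq> k" for a
    proof -
      obtain x where x: "{p, x} \<in> F a" "{p, x} \<inter> X = {p}" "a \<in> U"
        using a r by (elim C_E)
      then show ?thesis using distinct_colours_same_end[OF r M a(2)] y by metis
    qed
    then show False using i l colour_unique by blast
  qed
  show ?thesis
  proof (rule hub_bound[OF r])
    fix p p' assume "{p, p'} \<in> M" "p \<noteq> p'" and "C p \<noteq> {}" "C p' \<noteq> {}"
    then show "card (C p) + card (C p') \<le> 4"
      using two[of p p'] two[of p' p] by (simp add: insert_commute)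
  next
    fix j u v u' v'
    assume M: "{u, v} \<in> M" "{u', v'} \<in> M" and dist: "distinct [u, v, u', v']"
      and big: "card (C u) > 4" "card (C u') > 4" and j: "j \<in> U"
    show "{v, v'} \<notin> F j"
    proof
      assume h: "{v, v'} \<in> F j"
      have "card {j} < card (C u)" using big by simp
      then obtain a where a: "a \<in> C u" "a \<notin> {j}" by (elim exists_other_colour) auto
      obtain x where x: "{u, x} \<in> F a" "x \<notin> X" "{u, x} \<inter> X = {u}" "a \<in> U"
        using a r by (elim C_E)
      have "card {j, a} < card (C u')" using big card_insert_le_m1[of 2 "{a}" j] by simp
      then obtain b where b: "b \<in> C u'" "b \<notin> {j, a}" by (elim exists_other_colour) auto
      \<comment> \<open>A pentagon is no contradiction here, so a second colour \<open>b'\<close> at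
        \<open>u'\<close> is taken: the edges of \<open>b\<close> and \<open>b'\<close> would both
        be \<open>{u', x}\<close>.\<close>
      have "card {j, a, b} < card (C u')"
        using big card_insert_le_m1[of 3 "{a, b}" j] card_insert_le_m1[of 2 "{b}" a] by simp
      then obtain b' where b': "b' \<in> C u'" "b' \<notin> {j, a, b}" by (elim exists_other_colour) auto
      have "{u', x} \<in> F k \<and> k \<in> U" if k: "k \<in> C u'" "k \<notin> {j, a}" for k
      proof -
        obtain y where y: "{u', y} \<in> F k" "y \<notin> X" "{u', y} \<inter> X = {u'}" "k \<in> U"
          using k r by (elim C_E)
        have "{u, x} \<inter> {u', y} \<noteq> {}"
          using two_three_exchange[of "{u, v}" "{u', v'}" u v u' v' j a k] M dist j a k h x y by auto
        moreover have "u \<in> X" "u' \<in> X" using M by (auto simp: X_def)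
        ultimately have "x = y" using dist x y by auto
        then show ?thesis using y by simp
      qed
      then show False using b b' colour_unique by blast
    qed
  qed
qed

end

section \<open>Existence of a maximal rainbow matching and conclusion\<close>

lemma exists_maximal_rainbow_matching:
  fixes E :: "'a set set"
  assumes "r \<ge> 1" "uniform_hypergraph r V E" "matching_family E n F"
  obtains M c where "rainbow_matching E n F M" "maximal_rainbow_matching r n V E F M c"
proof -
  have bound: "card M \<le> n" if "rainbow_matching E n F M" for M
  proof -
    from that obtain c where "inj_on c M" "c ` M \<subseteq> {1..n}"
      unfolding rainbow_matching_def by blast
    then show ?thesis using card_inj_on_le[of c M "{1..n}"] by simp
  qed
  have "rainbow_matching E n F {}" by (simp add: rainbow_matching_def matching_def)
  then obtain M where M: "rainbow_matching E n F M"
    and max: "\<And>M'. rainbow_matching E n F M' \<Longrightarrow> card M' \<le> card M"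
    using ex_has_greatest_nat[of "rainbow_matching E n F" "{}" card "Suc n"] bound
    by (metis less_Suc_eq_le)
  obtain c where "inj_on c M" "\<forall>x\<in>M. c x \<in> {1..n} \<and> x \<in> F (c x)" "matching E M"
    using M by (auto simp: rainbow_matching_def)
  then have "maximal_rainbow_matching r n V E F M c"
    using assms max by unfold_locales auto
  then show ?thesis using that M by blast
qed

theorem theorem1p2:
  fixes n :: nat
  assumes "n \<ge> 1"
  shows
    "(\<forall>(V :: 'a set) E F. simple_graph V E \<and> matching_family E n F \<longrightarrow>
        (\<exists>M. rainbow_matching E n F M \<and> real (card M) \<ge> 2 / 3 * real n - 4 / 3))
   \<and> (\<forall>(r :: nat) (V :: 'a set) E F. r \<ge> 2 \<and> uniform_hypergraph r V E \<and> matching_family E n F \<longrightarrow>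
        (\<exists>M. rainbow_matching E n F M \<and>
             real (card M) \<ge> (real n - 1 / 2 - 3 / (4 * real r - 6)) / (real r - 1 / 2)))
   \<and> (\<forall>(V :: 'a set) E F. simple_graph V E \<and> matching_family E n F \<and>
          \<not> (\<exists>vs. cycle E vs \<and> length vs = 3) \<and> \<not> (\<exists>vs. cycle E vs \<and> length vs = 5) \<longrightarrow>
        (\<exists>M. rainbow_matching E n F M \<and> real (card M) \<ge> 3 / 4 * real n - 9 / 4))
   \<and> (\<forall>(V :: 'a set) E F. simple_graph V E \<and> matching_family E n F \<and>
          disjoint_family_on F {1..n} \<longrightarrow>
        (\<exists>M. rainbow_matching E n F M \<and> real (card M) \<ge> 3 / 4 * real n - 9 / 2))"
proof (intro conjI allI impI; elim conjE)
  fix V :: "'a set" and E F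
  assume *: "simple_graph V E" "matching_family E n F"
  obtain M c where M: "rainbow_matching E n F M" "maximal_rainbow_matching 2 n V E F M c"
    using exists_maximal_rainbow_matching[OF _ *] by auto
  \<comment> \<open>For \<open>r = 2\<close> the uniform bound is
    \<open>(n - 2) / (3 / 2)\<close>.\<close>
  show "\<exists>M. rainbow_matching E n F M \<and> real (card M) \<ge> 2 / 3 * real n - 4 / 3"
    using M(1) maximal_rainbow_matching.uniform_bound[OF M(2)] by (auto simp: field_simps)
next
  fix r and V :: "'a set" and E F
  assume r: "r \<ge> 2" and *: "uniform_hypergraph r V E" "matching_family E n F"
  obtain M c where M: "rainbow_matching E n F M" "maximal_rainbow_matching r n V E F M c"
    using r exists_maximal_rainbow_matching[OF _ *] by auto
  show "\<exists>M. rainbow_matching E n F M \<and>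
      real (card M) \<ge> (real n - 1 / 2 - 3 / (4 * real r - 6)) / (real r - 1 / 2)"
    using M(1) maximal_rainbow_matching.uniform_bound[OF M(2) r] by blast
next
  fix V :: "'a set" and E F
  assume *: "simple_graph V E" "matching_family E n F"
    and cycles: "\<not> (\<exists>vs. cycle E vs \<and> length vs = 3)" "\<not> (\<exists>vs. cycle E vs \<and> length vs = 5)"
  obtain M c where M: "rainbow_matching E n F M" "maximal_rainbow_matching 2 n V E F M c"
    using exists_maximal_rainbow_matching[OF _ *] by auto
  \<comment> \<open>As \<open>n = card M + card U\<close>, the two cases give
    \<open>card M \<ge> n - 2\<close> and \<open>4 * card M \<ge> 3 * n - 2\<close>; either
    suffices.\<close>
  show "\<exists>M. rainbow_matching E n F M \<and> real (card M) \<ge> 3 / 4 * real n - 9 / 4"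
    using M(1) maximal_rainbow_matching.no_C3_C5_bound[OF M(2) refl cycles]
      maximal_rainbow_matching.card_U[OF M(2)] assms
    by (intro exI[of _ M]) auto
next
  fix V :: "'a set" and E F
  assume *: "simple_graph V E" "matching_family E n F" and disj: "disjoint_family_on F {1..n}"
  obtain M c where M: "rainbow_matching E n F M" "maximal_rainbow_matching 2 n V E F M c"
    using exists_maximal_rainbow_matching[OF _ *] by auto
  \<comment> \<open>Likewise the cases give \<open>card M \<ge> n - 4\<close> and
    \<open>4 * card M \<ge> 3 * n - 4\<close>.\<close>
  show "\<exists>M. rainbow_matching E n F M \<and> real (card M) \<ge> 3 / 4 * real n - 9 / 2"
    using M(1) maximal_rainbow_matching.disjoint_bound[OF M(2) refl disj]
      maximal_rainbow_matching.card_U[OF M(2)] assms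
    by (intro exI[of _ M]) auto
qed

end
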